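(* For a monoidal coalgebra modality $(!,\delta,\varepsilon,\Delta,\mathsf{e},\mathsf{m},\mathsf{m}_I)$ on a symmetric monoidal category, if a pre-codereliction exists, then it is unique.
   Context: Conventions: composition is written diagrammatically, $f;g$ means first $f$ then $g$. Symmetric monoidal categories are taken to be strict, with product $\otimes$, unit $I$, symmetry $\sigma_{A,B}:A\otimes B\to B\otimes A$. Coalgebra modality $(!,\delta,\varepsilon,\Delta,\mathsf{e})$: a comonad $(!,\delta,\varepsilon)$, with $\delta_A:!(A)\to!!(A)$, $\varepsilon_A:!(A)\to A$, together with natural transformations $\Delta_A:!(A)\to!(A)\otimes!(A)$, $\mathsf{e}_A:!(A)\to I$ such that each $(!(A),\Delta_A,\mathsf{e}_A)$ is a cocommutative comonoid and $\delta_A$ is a comonoid morphism: $\delta_A;\Delta_{!(A)}=\Delta_A;(\delta_A\otimes\delta_A)$, $\delta_A;\mathsf{e}_{!(A)}=\mathsf{e}_A$. Monoidal coalgebra modality $(!,\delta,\varepsilon,\Delta,\mathsf{e},\mathsf{m},\mathsf{m}_I)$: a coalgebra modality with a natural transformation $\mathsf{m}_{A,B}:!(A)\otimes!(B)\to!(A\otimes B)$ and a map $\mathsf{m}_I:I\to!(I)$ making $!$ a symmetric (lax) monoidal endofunctor, such that - $\mathsf{m}_{A,B};\delta_{A\otimes B}=(\delta_A\otimes\delta_B);\mathsf{m}_{!(A),!(B)};!(\mathsf{m}_{A,B})$, $\mathsf{m}_I;\delta_I=\mathsf{m}_I;!(\mathsf{m}_I)$, $\mathsf{m}_{A,B};\varepsilon_{A\otimes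 B}=\varepsilon_A\otimes\varepsilon_B$, $\mathsf{m}_I;\varepsilon_I=1_I$; - $\mathsf{m}_{A,B};\Delta_{A\otimes B}=(\Delta_A\otimes\Delta_B);(1\otimes\sigma_{!(A),!(B)}\otimes1);(\mathsf{m}_{A,B}\otimes\mathsf{m}_{A,B})$, $\mathsf{m}_{A,B};\mathsf{e}_{A\otimes B}=\mathsf{e}_A\otimes\mathsf{e}_B$, $\mathsf{m}_I;\Delta_I=\mathsf{m}_I\otimes\mathsf{m}_I$, $\mathsf{m}_I;\mathsf{e}_I=1_I$; - $\delta_A;!(\Delta_A)=\Delta_A;(\delta_A\otimes\delta_A);\mathsf{m}_{!(A),!(A)}$, $\delta_A;!(\mathsf{e}_A)=\mathsf{e}_A;\mathsf{m}_I$. Pre-codereliction for a monoidal coalgebra modality: a natural transformation $\eta_A:A\to!(A)$ such that $\eta_A;\varepsilon_A=1_A$, $(\eta_A\otimes1_{!(B)});\mathsf{m}_{A,B}=(1_A\otimes\varepsilon_B);\eta_{A\otimes B}$, and $(1_{!(A)}\otimes\eta_B);\mathsf{m}_{A,B}=(\varepsilon_A\otimes1_B);\eta_{A\otimes B}$. *)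

theory Defs
  imports Main
begin

text \<open>
  Composition is diagrammatic: \<open>f ;; g\<close> means first \<open>f\<close>, then \<open>g\<close>.  Every arrow has one domain and
  one codomain, so hom-sets are disjoint.  Operations are total HOL functions, and only their values
  on \<open>Obj C\<close>, \<open>Arr C\<close> and composable pairs are constrained.
\<close>

record ('o, 'm) smc =
  Obj :: "'o set"
  Arr :: "'m set"
  Dom :: "'m \<Rightarrow> 'o"
  Cod :: "'m \<Rightarrow> 'o"
  ident :: "'o \<Rightarrow> 'm" (\<open>\<one>\<index>\<close>)
  comp :: "'m \<Rightarrow> 'm \<Rightarrow> 'm" (infixl \<open>;;\<index>\<close> 65)
  tensor_ob :: "'o \<Rightarrow> 'o \<Rightarrow> 'o" (infixr \<open>\<odot>\<index>\<close> 70)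
  tensor :: "'m \<Rightarrow> 'm \<Rightarrow> 'm" (infixr \<open>\<otimes>\<index>\<close> 70)
  unit_ob :: "'o" (\<open>\<I>\<index>\<close>)
  symm :: "'o \<Rightarrow> 'o \<Rightarrow> 'm" (\<open>\<sigma>\<index>\<close>)

definition hom :: "('o, 'm) smc \<Rightarrow> 'o \<Rightarrow> 'o \<Rightarrow> 'm set" where
  "hom C A B = {f \<in> Arr C. Dom C f = A \<and> Cod C f = B}"

locale category =
  fixes C :: "('o, 'm) smc" (structure)
  assumes Dom_Obj: "f \<in> Arr C \<Longrightarrow> Dom C f \<in> Obj C"
    and Cod_Obj: "f \<in> Arr C \<Longrightarrow> Cod C f \<in> Obj C"
    and ident_hom: "A \<in> Obj C \<Longrightarrow> \<one> A \<in> hom C A A"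
    and comp_hom: "\<lbrakk>f \<in> hom C A B; g \<in> hom C B D\<rbrakk> \<Longrightarrow> f ;; g \<in> hom C A D"
    and ident_comp: "f \<in> hom C A B \<Longrightarrow> \<one> A ;; f = f"
    and comp_ident: "f \<in> hom C A B \<Longrightarrow> f ;; \<one> B = f"
    and comp_assoc: "\<lbrakk>f \<in> hom C A B; g \<in> hom C B D; h \<in> hom C D E\<rbrakk> \<Longrightarrow> (f ;; g) ;; h = f ;; (g ;; h)"

text \<open>Objects are compared by equality, so strictness means that the tensor of objects and the tensor
  of arrows are both associative and unital on the nose.\<close>

locale symmetric_monoidal_category = category C
  for C :: "('o, 'm) smc" (structure) +
  assumes tensor_ob_Obj: "\<lbrakk>A \<in> Obj C; B \<in> Obj C\<rbrakk> \<Longrightarrow> A \<odot> B \<in> Obj C"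
    and unit_Obj: "\<I> \<in> Obj C"
    and tensor_hom: "\<lbrakk>f \<in> hom C A B; g \<in> hom C A' B'\<rbrakk> \<Longrightarrow> f \<otimes> g \<in> hom C (A \<odot> A') (B \<odot> B')"
    and tensor_ident: "\<lbrakk>A \<in> Obj C; B \<in> Obj C\<rbrakk> \<Longrightarrow> \<one> A \<otimes> \<one> B = \<one> (A \<odot> B)"
    and tensor_comp: "\<lbrakk>f \<in> hom C A B; g \<in> hom C B D; f' \<in> hom C A' B'; g' \<in> hom C B' D'\<rbrakk>
          \<Longrightarrow> (f ;; g) \<otimes> (f' ;; g') = (f \<otimes> f') ;; (g \<otimes> g')"
    and tensor_ob_assoc: "\<lbrakk>A \<in> Obj C; B \<in> Obj C; D \<in> Obj C\<rbrakk> \<Longrightarrow> (A \<odot> B) \<odot> D = A \<odot> (B \<odot> D)"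
    and tensor_ob_unit_left: "A \<in> Obj C \<Longrightarrow> \<I> \<odot> A = A"
    and tensor_ob_unit_right: "A \<in> Obj C \<Longrightarrow> A \<odot> \<I> = A"
    and tensor_assoc: "\<lbrakk>f \<in> Arr C; g \<in> Arr C; h \<in> Arr C\<rbrakk> \<Longrightarrow> (f \<otimes> g) \<otimes> h = f \<otimes> (g \<otimes> h)"
    and tensor_unit_left: "f \<in> Arr C \<Longrightarrow> \<one> \<I> \<otimes> f = f"
    and tensor_unit_right: "f \<in> Arr C \<Longrightarrow> f \<otimes> \<one> \<I> = f"
    and symm_hom: "\<lbrakk>A \<in> Obj C; B \<in> Obj C\<rbrakk> \<Longrightarrow> \<sigma> A B \<in> hom C (A \<odot> B) (B \<odot> A)"
    and symm_natural: "\<lbrakk>f \<in> hom C A B; g \<in> hom C A' B'\<rbrakk> \<Longrightarrow> (f \<otimes> g) ;; \<sigma> B B' = \<sigma> A A' ;; (g \<otimes> f)"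
    and symm_symm: "\<lbrakk>A \<in> Obj C; B \<in> Obj C\<rbrakk> \<Longrightarrow> \<sigma> A B ;; \<sigma> B A = \<one> (A \<odot> B)"
    and symm_unit: "A \<in> Obj C \<Longrightarrow> \<sigma> A \<I> = \<one> A"
    and symm_hexagon: "\<lbrakk>A \<in> Obj C; B \<in> Obj C; D \<in> Obj C\<rbrakk>
          \<Longrightarrow> \<sigma> A (B \<odot> D) = (\<sigma> A B \<otimes> \<one> D) ;; (\<one> B \<otimes> \<sigma> A D)"

text \<open>A functor is given by its action \<open>F\<close> on objects and its action \<open>Fm\<close> on arrows.\<close>

definition (in category) endofunctor :: "('o \<Rightarrow> 'o) \<Rightarrow> ('m \<Rightarrow> 'm) \<Rightarrow> bool" where
  "endofunctor F Fm \<longleftrightarrow>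
     (\<forall>A\<in>Obj C. F A \<in> Obj C) \<and>
     (\<forall>A B f. f \<in> hom C A B \<longrightarrow> Fm f \<in> hom C (F A) (F B)) \<and>
     (\<forall>A\<in>Obj C. Fm (\<one> A) = \<one> (F A)) \<and>
     (\<forall>A B D f g. f \<in> hom C A B \<and> g \<in> hom C B D \<longrightarrow> Fm (f ;; g) = Fm f ;; Fm g)"

definition (in category) natural ::
  "('o \<Rightarrow> 'o) \<Rightarrow> ('m \<Rightarrow> 'm) \<Rightarrow> ('o \<Rightarrow> 'o) \<Rightarrow> ('m \<Rightarrow> 'm) \<Rightarrow> ('o \<Rightarrow> 'm) \<Rightarrow> bool" where
  "natural F Fm G Gm \<tau> \<longleftrightarrow>
     (\<forall>A\<in>Obj C. \<tau> A \<in> hom C (F A) (G A)) \<and>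
     (\<forall>A B f. f \<in> hom C A B \<longrightarrow> Fm f ;; \<tau> B = \<tau> A ;; Gm f)"

definition (in category) comonad ::
  "('o \<Rightarrow> 'o) \<Rightarrow> ('m \<Rightarrow> 'm) \<Rightarrow> ('o \<Rightarrow> 'm) \<Rightarrow> ('o \<Rightarrow> 'm) \<Rightarrow> bool" where
  "comonad T Tm \<delta> \<epsilon> \<longleftrightarrow>
     endofunctor T Tm \<and>
     natural T Tm (\<lambda>A. T (T A)) (\<lambda>f. Tm (Tm f)) \<delta> \<and>
     natural T Tm (\<lambda>A. A) (\<lambda>f. f) \<epsilon> \<and>
     (\<forall>A\<in>Obj C. \<delta> A ;; \<epsilon> (T A) = \<one> (T A) \<and>
                \<delta> A ;; Tm (\<epsilon> A) = \<one> (T A) \<and>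
                \<delta> A ;; \<delta> (T A) = \<delta> A ;; Tm (\<delta> A))"

definition (in symmetric_monoidal_category) cocommutative_comonoid :: "'o \<Rightarrow> 'm \<Rightarrow> 'm \<Rightarrow> bool" where
  "cocommutative_comonoid A d u \<longleftrightarrow>
     A \<in> Obj C \<and> d \<in> hom C A (A \<odot> A) \<and> u \<in> hom C A \<I> \<and>
     d ;; (d \<otimes> \<one> A) = d ;; (\<one> A \<otimes> d) \<and>
     d ;; (u \<otimes> \<one> A) = \<one> A \<and>
     d ;; (\<one> A \<otimes> u) = \<one> A \<and>
     d ;; \<sigma> A A = d"

definition (in symmetric_monoidal_category) symmetric_monoidal_endofunctor ::
  "('o \<Rightarrow> 'o) \<Rightarrow> ('m \<Rightarrow> 'm) \<Rightarrow> ('o \<Rightarrow> 'o \<Rightarrow> 'm) \<Rightarrow> 'm \<Rightarrow> bool" where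
  "symmetric_monoidal_endofunctor T Tm m m\<^sub>I \<longleftrightarrow>
     endofunctor T Tm \<and>
     (\<forall>A\<in>Obj C. \<forall>B\<in>Obj C. m A B \<in> hom C (T A \<odot> T B) (T (A \<odot> B))) \<and>
     (\<forall>A B A' B' f g. f \<in> hom C A B \<and> g \<in> hom C A' B' \<longrightarrow>
        (Tm f \<otimes> Tm g) ;; m B B' = m A A' ;; Tm (f \<otimes> g)) \<and>
     m\<^sub>I \<in> hom C \<I> (T \<I>) \<and>
     (\<forall>A\<in>Obj C. \<forall>B\<in>Obj C. \<forall>D\<in>Obj C.
        (m A B \<otimes> \<one> (T D)) ;; m (A \<odot> B) D = (\<one> (T A) \<otimes> m B D) ;; m A (B \<odot> D)) \<and>
     (\<forall>A\<in>Obj C. (m\<^sub>I \<otimes> \<one> (T A)) ;; m \<I> A = \<one> (T A) \<and>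
                (\<one> (T A) \<otimes> m\<^sub>I) ;; m A \<I> = \<one> (T A)) \<and>
     (\<forall>A\<in>Obj C. \<forall>B\<in>Obj C. \<sigma> (T A) (T B) ;; m B A = m A B ;; Tm (\<sigma> A B))"

text \<open>Below, \<open>T\<close> and \<open>Tm\<close> are the actions of the functor \<open>!\<close> on objects and on arrows.\<close>

locale coalgebra_modality = symmetric_monoidal_category C
  for C :: "('o, 'm) smc" (structure) +
  fixes T :: "'o \<Rightarrow> 'o" and Tm :: "'m \<Rightarrow> 'm"
    and \<delta> :: "'o \<Rightarrow> 'm" and \<epsilon> :: "'o \<Rightarrow> 'm"
    and \<Delta> :: "'o \<Rightarrow> 'm" and e :: "'o \<Rightarrow> 'm"
  assumes comonad: "comonad T Tm \<delta> \<epsilon>"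
    and Delta_natural: "natural T Tm (\<lambda>A. T A \<odot> T A) (\<lambda>f. Tm f \<otimes> Tm f) \<Delta>"
    and e_natural: "natural T Tm (\<lambda>A. \<I>) (\<lambda>f. \<one> \<I>) e"
    and comonoid: "A \<in> Obj C \<Longrightarrow> cocommutative_comonoid (T A) (\<Delta> A) (e A)"
    and delta_Delta: "A \<in> Obj C \<Longrightarrow> \<delta> A ;; \<Delta> (T A) = \<Delta> A ;; (\<delta> A \<otimes> \<delta> A)"
    and delta_e: "A \<in> Obj C \<Longrightarrow> \<delta> A ;; e (T A) = e A"

locale monoidal_coalgebra_modality = coalgebra_modality C T Tm \<delta> \<epsilon> \<Delta> e
  for C :: "('o, 'm) smc" (structure) and T Tm \<delta> \<epsilon> \<Delta> e +
  fixes m :: "'o \<Rightarrow> 'o \<Rightarrow> 'm" and m\<^sub>I :: 'm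
  assumes symmetric_monoidal: "symmetric_monoidal_endofunctor T Tm m m\<^sub>I"
    and m_delta: "\<lbrakk>A \<in> Obj C; B \<in> Obj C\<rbrakk>
          \<Longrightarrow> m A B ;; \<delta> (A \<odot> B) = (\<delta> A \<otimes> \<delta> B) ;; m (T A) (T B) ;; Tm (m A B)"
    and mI_delta: "m\<^sub>I ;; \<delta> \<I> = m\<^sub>I ;; Tm m\<^sub>I"
    and m_epsilon: "\<lbrakk>A \<in> Obj C; B \<in> Obj C\<rbrakk> \<Longrightarrow> m A B ;; \<epsilon> (A \<odot> B) = \<epsilon> A \<otimes> \<epsilon> B"
    and mI_epsilon: "m\<^sub>I ;; \<epsilon> \<I> = \<one> \<I>"
    and m_Delta: "\<lbrakk>A \<in> Obj C; B \<in> Obj C\<rbrakk>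
          \<Longrightarrow> m A B ;; \<Delta> (A \<odot> B)
              = (\<Delta> A \<otimes> \<Delta> B) ;; (\<one> (T A) \<otimes> \<sigma> (T A) (T B) \<otimes> \<one> (T B)) ;; (m A B \<otimes> m A B)"
    and m_e: "\<lbrakk>A \<in> Obj C; B \<in> Obj C\<rbrakk> \<Longrightarrow> m A B ;; e (A \<odot> B) = e A \<otimes> e B"
    and mI_Delta: "m\<^sub>I ;; \<Delta> \<I> = m\<^sub>I \<otimes> m\<^sub>I"
    and mI_e: "m\<^sub>I ;; e \<I> = \<one> \<I>"
    and delta_T_Delta: "A \<in> Obj C \<Longrightarrow> \<delta> A ;; Tm (\<Delta> A) = \<Delta> A ;; (\<delta> A \<otimes> \<delta> A) ;; m (T A) (T A)"
    and delta_T_e: "A \<in> Obj C \<Longrightarrow> \<delta> A ;; Tm (e A) = e A ;; m\<^sub>I"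

locale pre_codereliction = monoidal_coalgebra_modality C T Tm \<delta> \<epsilon> \<Delta> e m m\<^sub>I
  for C :: "('o, 'm) smc" (structure) and T Tm \<delta> \<epsilon> \<Delta> e m m\<^sub>I +
  fixes \<eta> :: "'o \<Rightarrow> 'm"
  assumes eta_natural: "natural (\<lambda>A. A) (\<lambda>f. f) T Tm \<eta>"
    and eta_epsilon: "A \<in> Obj C \<Longrightarrow> \<eta> A ;; \<epsilon> A = \<one> A"
    and eta_m_left: "\<lbrakk>A \<in> Obj C; B \<in> Obj C\<rbrakk>
          \<Longrightarrow> (\<eta> A \<otimes> \<one> (T B)) ;; m A B = (\<one> A \<otimes> \<epsilon> B) ;; \<eta> (A \<odot> B)"
    and eta_m_right: "\<lbrakk>A \<in> Obj C; B \<in> Obj C\<rbrakk>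
          \<Longrightarrow> (\<one> (T A) \<otimes> \<eta> B) ;; m A B = (\<epsilon> A \<otimes> \<one> B) ;; \<eta> (A \<odot> B)"

end

theory Submission
  imports Defs
begin

text \<open>
  Let \<open>\<eta>\<close> and \<open>\<eta>'\<close> be pre-coderelictions.  The arrow \<open>(\<eta> A \<otimes> \<eta>' B) ;; m A B\<close> can be evaluated in two
  ways.  The law for \<open>\<eta>\<close> on the left turns it into \<open>\<eta> (A \<odot> B)\<close>, up to a factor \<open>\<eta>' B ;; \<epsilon> B\<close>, which
  is the identity; the law for \<open>\<eta>'\<close> on the right likewise turns it into \<open>\<eta>' (A \<odot> B)\<close>.  So the two
  agree on every tensor product, and every object is one, because \<open>A = \<I> \<odot> A\<close>.
  Each evaluation uses only that the other tensor factor is a section of \<open>\<epsilon>\<close>, and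
  the lemmas \<open>eta_tensor_section_m\<close> and \<open>section_tensor_eta_m\<close> are stated for such a section.
\<close>

lemma (in category) hom_objects:
  assumes "f \<in> hom C A B"
  shows "A \<in> Obj C" and "B \<in> Obj C"
  using assms Dom_Obj Cod_Obj by (auto simp: hom_def)

context symmetric_monoidal_category
begin

lemma tensor_split_right_first:
  assumes f: "f \<in> hom C A B" and g: "g \<in> hom C A' B'"
  shows "f \<otimes> g = (\<one> A \<otimes> g) ;; (f \<otimes> \<one> B')"
  using tensor_comp[OF ident_hom f g ident_hom] hom_objects[OF f] hom_objects[OF g]
    ident_comp[OF f] comp_ident[OF g] by simp

lemma tensor_split_left_first:
  assumes f: "f \<in> hom C A B" and g: "g \<in> hom C A' B'"
  shows "f \<otimes> g = (f \<otimes> \<one> A') ;; (\<one> B \<otimes> g)"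
  using tensor_comp[OF f ident_hom ident_hom g] hom_objects[OF f] hom_objects[OF g]
    comp_ident[OF f] ident_comp[OF g] by simp

end

context monoidal_coalgebra_modality
begin

lemma epsilon_hom: "A \<in> Obj C \<Longrightarrow> \<epsilon> A \<in> hom C (T A) A"
  using comonad by (auto simp: comonad_def natural_def)

lemma T_Obj: "A \<in> Obj C \<Longrightarrow> T A \<in> Obj C"
  using comonad by (auto simp: comonad_def endofunctor_def)

lemma m_hom: "\<lbrakk>A \<in> Obj C; B \<in> Obj C\<rbrakk> \<Longrightarrow> m A B \<in> hom C (T A \<odot> T B) (T (A \<odot> B))"
  using symmetric_monoidal by (auto simp: symmetric_monoidal_endofunctor_def)

end

context pre_codereliction
begin

lemma eta_hom: "A \<in> Obj C \<Longrightarrow> \<eta> A \<in> hom C A (T A)"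
  using eta_natural by (auto simp: natural_def)

text \<open>Once \<open>s\<close> is moved before \<open>\<eta> A\<close>, the law \<open>eta_m_left\<close> trades \<open>m A B\<close> for \<open>\<epsilon> B\<close>, which cancels \<open>s\<close>.\<close>

lemma eta_tensor_section_m:
  assumes A: "A \<in> Obj C" and s: "s \<in> hom C B (T B)" and s_section: "s ;; \<epsilon> B = \<one> B"
  shows "(\<eta> A \<otimes> s) ;; m A B = \<eta> (A \<odot> B)"
proof -
  have B: "B \<in> Obj C"
    using hom_objects[OF s] by simp
  note homs = A B T_Obj ident_hom tensor_hom eta_hom s epsilon_hom m_hom tensor_ob_Obj
  have "(\<eta> A \<otimes> s) ;; m A B = (\<one> A \<otimes> s) ;; (\<eta> A \<otimes> \<one> (T B)) ;; m A B"
    using tensor_split_right_first[OF eta_hom[OF A] s] by simp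
  also have "\<dots> = (\<one> A \<otimes> s) ;; ((\<eta> A \<otimes> \<one> (T B)) ;; m A B)"
    by (rule comp_assoc) (rule homs)+
  also have "\<dots> = (\<one> A \<otimes> s) ;; ((\<one> A \<otimes> \<epsilon> B) ;; \<eta> (A \<odot> B))"
    using eta_m_left A B by simp
  also have "\<dots> = (\<one> A \<otimes> s) ;; (\<one> A \<otimes> \<epsilon> B) ;; \<eta> (A \<odot> B)"
    by (rule comp_assoc[symmetric]) (rule homs)+
  also have "(\<one> A \<otimes> s) ;; (\<one> A \<otimes> \<epsilon> B) = (\<one> A ;; \<one> A) \<otimes> (s ;; \<epsilon> B)"
    by (rule tensor_comp[symmetric]) (rule homs)+
  also have "\<dots> = \<one> (A \<odot> B)"
    using s_section ident_comp[OF ident_hom[OF A]] tensor_ident A B by simp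
  also have "\<one> (A \<odot> B) ;; \<eta> (A \<odot> B) = \<eta> (A \<odot> B)"
    by (rule ident_comp) (rule homs)+
  finally show ?thesis .
qed

lemma section_tensor_eta_m:
  assumes s: "s \<in> hom C A (T A)" and s_section: "s ;; \<epsilon> A = \<one> A" and B: "B \<in> Obj C"
  shows "(s \<otimes> \<eta> B) ;; m A B = \<eta> (A \<odot> B)"
proof -
  have A: "A \<in> Obj C"
    using hom_objects[OF s] by simp
  note homs = A B T_Obj ident_hom tensor_hom eta_hom s epsilon_hom m_hom tensor_ob_Obj
  have "(s \<otimes> \<eta> B) ;; m A B = (s \<otimes> \<one> B) ;; (\<one> (T A) \<otimes> \<eta> B) ;; m A B"
    using tensor_split_left_first[OF s eta_hom[OF B]] by simp
  also have "\<dots> = (s \<otimes> \<one> B) ;; ((\<one> (T A) \<otimes> \<eta> B) ;; m A B)"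
    by (rule comp_assoc) (rule homs)+
  also have "\<dots> = (s \<otimes> \<one> B) ;; ((\<epsilon> A \<otimes> \<one> B) ;; \<eta> (A \<odot> B))"
    using eta_m_right A B by simp
  also have "\<dots> = (s \<otimes> \<one> B) ;; (\<epsilon> A \<otimes> \<one> B) ;; \<eta> (A \<odot> B)"
    by (rule comp_assoc[symmetric]) (rule homs)+
  also have "(s \<otimes> \<one> B) ;; (\<epsilon> A \<otimes> \<one> B) = (s ;; \<epsilon> A) \<otimes> (\<one> B ;; \<one> B)"
    by (rule tensor_comp[symmetric]) (rule homs)+
  also have "\<dots> = \<one> (A \<odot> B)"
    using s_section ident_comp[OF ident_hom[OF B]] tensor_ident A B by simp
  also have "\<one> (A \<odot> B) ;; \<eta> (A \<odot> B) = \<eta> (A \<odot> B)"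
    by (rule ident_comp) (rule homs)+
  finally show ?thesis .
qed

end

theorem proposition3p3:
  fixes C :: "('o, 'm) smc"
    and T :: "'o \<Rightarrow> 'o" and Tm :: "'m \<Rightarrow> 'm"
    and \<delta> \<epsilon> \<Delta> e :: "'o \<Rightarrow> 'm"
    and m :: "'o \<Rightarrow> 'o \<Rightarrow> 'm" and m\<^sub>I :: 'm
    and \<eta> \<eta>' :: "'o \<Rightarrow> 'm"
  assumes "monoidal_coalgebra_modality C T Tm \<delta> \<epsilon> \<Delta> e m m\<^sub>I"
    and "pre_codereliction C T Tm \<delta> \<epsilon> \<Delta> e m m\<^sub>I \<eta>"
    and "pre_codereliction C T Tm \<delta> \<epsilon> \<Delta> e m m\<^sub>I \<eta>'"
  shows "\<forall>A\<in>Obj C. \<eta> A = \<eta>' A"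
proof
  fix A
  assume A: "A \<in> Obj C"
  interpret eta: pre_codereliction C T Tm \<delta> \<epsilon> \<Delta> e m m\<^sub>I \<eta>
    by (rule assms(2))
  interpret eta': pre_codereliction C T Tm \<delta> \<epsilon> \<Delta> e m m\<^sub>I \<eta>'
    by (rule assms(3))
  note I = eta.unit_Obj
  have "\<eta> (\<I>\<^bsub>C\<^esub> \<odot>\<^bsub>C\<^esub> A) = (\<eta> \<I>\<^bsub>C\<^esub> \<otimes>\<^bsub>C\<^esub> \<eta>' A) ;;\<^bsub>C\<^esub> m \<I>\<^bsub>C\<^esub> A"
    by (rule eta.eta_tensor_section_m[OF I eta'.eta_hom[OF A] eta'.eta_epsilon[OF A], symmetric])
  also have "\<dots> = \<eta>' (\<I>\<^bsub>C\<^esub> \<odot>\<^bsub>C\<^esub> A)"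
    by (rule eta'.section_tensor_eta_m[OF eta.eta_hom[OF I] eta.eta_epsilon[OF I] A])
  finally show "\<eta> A = \<eta>' A"
    by (simp add: eta.tensor_ob_unit_left[OF A])
qed

end
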